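(* For an integer $r \ge 2$ let $\mathrm{QR}(r) = \{\, y^2 \bmod r : y = 0,1,\dots,r-1 \,\}\subseteq \mathbb{Z}/r\mathbb{Z}$. If an integer $\Delta$ is a perfect square, then $\Delta \in \mathrm{QR}(r)$ for every $r \ge 2$. Consequently (kill rule): let $N, A, p$ be positive integers, and put $S = A(p^2+p+1)$, $T = 2Np^2$ and $\Delta(p) = S^2 + 4(T-S)(S-1)$. If there exists an integer $r \ge 2$ with $\Delta(p) \notin \mathrm{QR}(r)$, then there is no integer $q$ with $$A\,(p^2+p+1)\,(q^2+q+1) = 2Np^2q^2 + 1.$$
   Context: An integer is identified with its residue class modulo $r$, so for an integer $\Delta$ the notation $\Delta \in \mathrm{QR}(r)$ means $(\Delta \bmod r) \in \mathrm{QR}(r)$. Note that $0 \in \mathrm{QR}(r)$, and that $\mathrm{QR}(r)$ is the set of residue classes modulo $r$ of all squares of integers. A perfect square means the square of an integer. *)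

theory Defs
  imports "HOL-Computational_Algebra.Nth_Powers"
begin

text \<open>
  Residue classes modulo \<open>r\<close> are represented by their least non-negative representatives
  \<open>0, \<dots>, r - 1\<close>. Accordingly, the statement that an integer \<open>\<Delta>\<close> belongs to \<open>QR r\<close> as a
  residue class is written \<open>\<Delta> mod r \<in> QR r\<close>.
\<close>

definition QR :: "int \<Rightarrow> int set" where
  "QR r = {y\<^sup>2 mod r | y. y \<in> {0..r - 1}}"

end

theory Submission
  imports Defs
begin

text \<open>
  Reduction modulo \<open>r\<close> is multiplicative, so squares reduce to squares: if \<open>\<Delta> = y\<^sup>2\<close>, then the
  residue of \<open>y\<close> witnesses \<open>\<Delta> mod r \<in> QR r\<close>. For the kill rule, read the equation
  \<open>S (q\<^sup>2 + q + 1) = T q\<^sup>2 + 1\<close> as \<open>(T - S) q\<^sup>2 - S q - (S - 1) = 0\<close>. Its discriminant is \<open>\<Delta>(p)\<close>,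
  and a quadratic equation with integer coefficients that has an integer root has a square
  discriminant. Hence a modulus in which \<open>\<Delta>(p)\<close> is not a square residue excludes every
  integer \<open>q\<close>.
\<close>

lemma square_mod_in_QR:
  fixes y r :: int
  assumes "r > 0"
  shows "y\<^sup>2 mod r \<in> QR r"
proof -
  have "y mod r \<in> {0..r - 1}"
    using assms by simp
  moreover have "y\<^sup>2 mod r = (y mod r)\<^sup>2 mod r"
    by (simp add: power_mod)
  ultimately show ?thesis
    unfolding QR_def by blast
qed

text \<open>
  Completing the square: multiplying the equation by \<open>4 a\<close> turns it into
  \<open>(2 a x + b)\<^sup>2 = b\<^sup>2 - 4 a c\<close>. Nothing is divided by \<open>a\<close>, so the degenerate case \<open>a = 0\<close>,
  which for the kill rule is \<open>S = T\<close>, is covered as well.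
\<close>

lemma discriminant_eq_square_of_root:
  fixes a b c x :: "'a :: comm_ring_1"
  assumes "a * x\<^sup>2 + b * x + c = 0"
  shows "b\<^sup>2 - 4 * a * c = (2 * a * x + b)\<^sup>2"
proof -
  have "(2 * a * x + b)\<^sup>2 = 4 * a * (a * x\<^sup>2 + b * x + c) + (b\<^sup>2 - 4 * a * c)"
    by (simp add: power2_eq_square algebra_simps)
  with assms show ?thesis
    by simp
qed

theorem lemma2:
  shows "(\<forall>\<Delta>::int. is_square \<Delta> \<longrightarrow> (\<forall>r\<ge>2. \<Delta> mod r \<in> QR r)) \<and>
    (\<forall>N A p S T \<Delta> :: int.
       N > 0 \<longrightarrow> A > 0 \<longrightarrow> p > 0 \<longrightarrow>
       S = A * (p\<^sup>2 + p + 1) \<longrightarrow> T = 2 * N * p\<^sup>2 \<longrightarrow>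
       \<Delta> = S\<^sup>2 + 4 * (T - S) * (S - 1) \<longrightarrow>
       (\<exists>r\<ge>2. \<Delta> mod r \<notin> QR r) \<longrightarrow>
       \<not> (\<exists>q::int. A * (p\<^sup>2 + p + 1) * (q\<^sup>2 + q + 1) = 2 * N * p\<^sup>2 * q\<^sup>2 + 1))"
proof (intro conjI allI impI notI)
  fix \<Delta> r :: int
  assume "is_square \<Delta>" and "r \<ge> 2"
  then show "\<Delta> mod r \<in> QR r"
    by (auto elim!: is_nth_powerE intro: square_mod_in_QR)
next
  fix N A p S T \<Delta> :: int
  assume S: "S = A * (p\<^sup>2 + p + 1)" and T: "T = 2 * N * p\<^sup>2"
    and \<Delta>: "\<Delta> = S\<^sup>2 + 4 * (T - S) * (S - 1)"
    and "\<exists>r\<ge>2. \<Delta> mod r \<notin> QR r"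
    and "\<exists>q::int. A * (p\<^sup>2 + p + 1) * (q\<^sup>2 + q + 1) = 2 * N * p\<^sup>2 * q\<^sup>2 + 1"
  then obtain r q where r: "r \<ge> 2" "\<Delta> mod r \<notin> QR r"
    and "S * (q\<^sup>2 + q + 1) = T * q\<^sup>2 + 1"
    by metis
  then have "(T - S) * q\<^sup>2 + (- S) * q + (1 - S) = 0"
    by (simp add: algebra_simps)
  from discriminant_eq_square_of_root[OF this]
  have "\<Delta> = (2 * (T - S) * q - S)\<^sup>2"
    by (simp add: \<Delta> algebra_simps)
  with r square_mod_in_QR[of r "2 * (T - S) * q - S"] show False
    by simp
qed

end
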